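(* Let $n\ge 1$. Every spreadable random partition $\Pi_n$ of $[n]$ that has at most two blocks (almost surely) is exchangeable.
   Context: $[n]=\{1,\dots,n\}$, and $\mathcal P_n$ is the finite set of all set partitions of $[n]$. A random partition of $[n]$ is a random variable $\Pi_n$ with values in $\mathcal P_n$. For $1\le j\le n$ the operator $D_j:\mathcal P_n\to\mathcal P_{n-1}$ deletes the element $j$ from its block (removing the block if it becomes empty) and then relabels the remaining elements by $[n-1]$ via the increasing bijection. $\Pi_n$ is spreadable if $D_1\Pi_n\stackrel{d}{=}D_2\Pi_n\stackrel{d}{=}\cdots\stackrel{d}{=}D_n\Pi_n$. $\Pi_n$ is exchangeable if $\mathbb P[\Pi_n=\pi_n]$ depends only on the multiset of block sizes of $\pi_n$; equivalently, its distribution is invariant under all permutations of $[n]$. *)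

theory Defs
  imports "HOL-Probability.Probability"
begin

definition set_partitions :: "nat \<Rightarrow> nat set set set" where
  "set_partitions n = {P. partition_on {1..n} P}"

definition close_gap :: "nat \<Rightarrow> nat \<Rightarrow> nat" where
  "close_gap j i = (if j < i then i - 1 else i)"

lemma strict_mono_on_close_gap: "strict_mono_on (- {j}) (close_gap j)"
  by (auto simp: strict_mono_on_def close_gap_def)

lemma bij_betw_close_gap:
  assumes "j \<in> {1..n}"
  shows "bij_betw (close_gap j) ({1..n} - {j}) {1..n - 1}"
proof (rule bij_betwI[where g = "\<lambda>k. if j \<le> k then k + 1 else k"])
qed (use assms in \<open>auto simp: close_gap_def split: if_splits\<close>)

text \<open>Deleting \<open>j\<close> from a partition; the singleton block \<open>{j}\<close>, if present, becomes empty and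
  is dropped.\<close>
definition delete_elem :: "nat \<Rightarrow> nat set set \<Rightarrow> nat set set" where
  "delete_elem j P = (\<lambda>B. close_gap j ` (B - {j})) ` P - {{}}"

lemma delete_elem_in_set_partitions:
  assumes j: "j \<in> {1..n}" and P: "P \<in> set_partitions n"
  shows "delete_elem j P \<in> set_partitions (n - 1)"
proof -
  have P': "partition_on {1..n} P" using P by (simp add: set_partitions_def)
  have inj: "inj_on (close_gap j) ({1..n} - {j})"
    and img: "close_gap j ` ({1..n} - {j}) = {1..n - 1}"
    using bij_betw_close_gap[OF j] by (auto simp: bij_betw_def)
  have sub: "B \<subseteq> {1..n}" if "B \<in> P" for B
    using P' that by (auto simp: partition_on_def)
  have un: "\<Union>(delete_elem j P) = close_gap j ` (\<Union>P - {j})"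
    by (auto simp: delete_elem_def)
  have "\<Union>(delete_elem j P) = {1..n - 1}"
    unfolding un using P' img by (simp add: partition_on_def)
  moreover have "disjoint (delete_elem j P)"
  proof (rule disjointI)
    fix a b assume a: "a \<in> delete_elem j P" and b: "b \<in> delete_elem j P" and ne: "a \<noteq> b"
    obtain A B where A: "A \<in> P" "a = close_gap j ` (A - {j})"
      and B: "B \<in> P" "b = close_gap j ` (B - {j})"
      using a b by (auto simp: delete_elem_def)
    have "A \<noteq> B" using A B ne by blast
    then have "A \<inter> B = {}" using P' A(1) B(1) by (simp add: partition_on_def disjoint_def)
    moreover have "a \<inter> b = close_gap j ` ((A - {j}) \<inter> (B - {j}))"
      unfolding A B
      by (rule inj_on_image_Int[OF inj, symmetric]) (use sub[OF A(1)] sub[OF B(1)] in auto)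
    ultimately show "a \<inter> b = {}" by auto
  qed
  moreover have "{} \<notin> delete_elem j P" by (simp add: delete_elem_def)
  ultimately show ?thesis by (simp add: set_partitions_def partition_on_def)
qed

definition random_partition :: "'w measure \<Rightarrow> nat \<Rightarrow> ('w \<Rightarrow> nat set set) \<Rightarrow> bool" where
  "random_partition M n X \<longleftrightarrow> X \<in> measurable M (count_space (set_partitions n))"

lemma random_partition_delete_elem:
  assumes "random_partition M n X" "j \<in> {1..n}"
  shows "random_partition M (n - 1) (\<lambda>\<omega>. delete_elem j (X \<omega>))"
  unfolding random_partition_def
  by (rule measurable_compose[OF assms(1)[unfolded random_partition_def]])
     (use delete_elem_in_set_partitions[OF assms(2)] in auto)

definition spreadable :: "'w measure \<Rightarrow> nat \<Rightarrow> ('w \<Rightarrow> nat set set) \<Rightarrow> bool" where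
  "spreadable M n X \<longleftrightarrow>
     (\<forall>i\<in>{1..n}. \<forall>j\<in>{1..n}.
        distr M (count_space (set_partitions (n - 1))) (\<lambda>\<omega>. delete_elem i (X \<omega>)) =
        distr M (count_space (set_partitions (n - 1))) (\<lambda>\<omega>. delete_elem j (X \<omega>)))"

definition block_sizes :: "nat set set \<Rightarrow> nat multiset" where
  "block_sizes P = image_mset card (mset_set P)"

definition exchangeable :: "'w measure \<Rightarrow> nat \<Rightarrow> ('w \<Rightarrow> nat set set) \<Rightarrow> bool" where
  "exchangeable M n X \<longleftrightarrow>
     (\<forall>P\<in>set_partitions n. \<forall>Q\<in>set_partitions n. block_sizes P = block_sizes Q \<longrightarrow>
        \<P>(\<omega> in M. X \<omega> = P) = \<P>(\<omega> in M. X \<omega> = Q))"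

end

(* A partition of [n] into at most two blocks is given by a subset A of [n], unique up to
   complement. If i and i+1 lie outside C, then deleting i+1 from the partition of
   C + {i} and deleting i from that of C + {i+1} give the same result R. Apart from these two
   partitions, the only preimage of R (under either deletion) with at most two blocks is the
   partition of C + {i, i+1}, so spreadability forces the first two to be equally likely.
   Such moves take every set to any other set of the same cardinality. *)
theory Submission
  imports Defs
begin

section \<open>Partitions with at most two blocks, encoded by subsets\<close>

text \<open>Dropping the empty set lets \<open>A = {}\<close> and \<open>A = {1..n}\<close> encode
  the one-block partition, and the empty partition when \<open>n = 0\<close>.\<close>

definition bipartition :: "nat \<Rightarrow> nat set \<Rightarrow> nat set set" where
  "bipartition n A = {A, {1..n} - A} - {{}}"

lemma set_partitions_card_le_2E:
  assumes P: "P \<in> set_partitions n" and c: "card P \<le> 2"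
  obtains A where "A \<subseteq> {1..n}" "P = bipartition n A"
proof -
  have part: "partition_on {1..n} P" using P by (simp add: set_partitions_def)
  have un: "\<Union>P = {1..n}" and ne: "{} \<notin> P" using part by (auto simp: partition_on_def)
  have "finite P" using part by (rule finite_elements[rotated]) simp
  consider "card P = 0" | "card P = 1" | "card P = 2" using c by linarith
  then show ?thesis
  proof cases
    case 1
    \<comment> \<open>The empty partition forces \<open>n = 0\<close>, where
      \<open>bipartition n {}\<close> has no block either.\<close>
    then have "P = {}" using \<open>finite P\<close> by simp
    then show ?thesis using un that[of "{}"] by (auto simp: bipartition_def)
  next
    case 2
    then obtain A where "P = {A}" by (auto simp: card_1_singleton_iff)
    moreover from this have "A = {1..n}" "A \<noteq> {}" using un ne by auto
    ultimately have "P = bipartition n A" by (simp add: bipartition_def insert_Diff_if)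
    then show ?thesis using \<open>A = {1..n}\<close> that[of A] by simp
  next
    case 3
    then obtain A B where AB: "P = {A, B}" "A \<noteq> B" by (auto simp: card_2_iff)
    then have "A \<inter> B = {}" using part by (auto simp: partition_on_def disjoint_def)
    then have "B = {1..n} - A" using AB un by auto
    then show ?thesis using AB un ne that[of A] by (auto simp: bipartition_def)
  qed
qed

lemma bipartition_in_set_partitions:
  assumes "A \<subseteq> {1..n}"
  shows "bipartition n A \<in> set_partitions n"
  using assms by (auto simp: set_partitions_def bipartition_def partition_on_def disjoint_def)

lemma bipartition_Diff:
  assumes "A \<subseteq> {1..n}"
  shows "bipartition n ({1..n} - A) = bipartition n A"
  using assms by (auto simp: bipartition_def double_diff)

text \<open>A nonempty \<open>A\<close> is itself a block of the partition, hence equal to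
  \<open>B\<close> or to its complement. An empty \<open>A\<close> is not a block; for
  \<open>n > 0\<close> it is recovered from the block \<open>{1..n}\<close>.\<close>

lemma bipartition_eq_iff:
  assumes A: "A \<subseteq> {1..n}" and B: "B \<subseteq> {1..n}"
  shows "bipartition n A = bipartition n B \<longleftrightarrow> A = B \<or> A = {1..n} - B"
proof
  assume eq: "bipartition n A = bipartition n B"
  show "A = B \<or> A = {1..n} - B"
  proof (cases "A = {}")
    case False
    then have "A \<in> bipartition n B" unfolding eq[symmetric] by (simp add: bipartition_def)
    then show ?thesis by (auto simp: bipartition_def)
  next
    case True
    show ?thesis
    proof (cases "{1..n} = {}")
      case True
      then show ?thesis using A B by blast
    next
      case False
      then have "{1..n} \<in> bipartition n B"
        unfolding eq[symmetric] using \<open>A = {}\<close> by (simp add: bipartition_def)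
      then have "{1..n} = B \<or> {1..n} = {1..n} - B" unfolding bipartition_def by blast
      then show ?thesis using True B by blast
    qed
  qed
next
  assume "A = B \<or> A = {1..n} - B"
  then show "bipartition n A = bipartition n B" using bipartition_Diff[OF B] by auto
qed

section \<open>Deleting an element from a bipartition\<close>

text \<open>Relabelling is injective away from \<open>j\<close>, so it commutes with taking
  complements.\<close>

lemma delete_elem_bipartition:
  assumes j: "j \<in> {1..n}" and A: "A \<subseteq> {1..n}"
  shows "delete_elem j (bipartition n A) = bipartition (n - 1) (close_gap j ` (A - {j}))"
proof -
  have inj: "inj_on (close_gap j) ({1..n} - {j})"
    and img: "close_gap j ` ({1..n} - {j}) = {1..n - 1}"
    using bij_betw_close_gap[OF j] by (auto simp: bij_betw_def)
  have "close_gap j ` (({1..n} - {j}) - (A - {j})) = {1..n - 1} - close_gap j ` (A - {j})"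
    unfolding img[symmetric]
    by (rule inj_on_image_set_diff[OF inj]) (use A in auto)
  moreover have "({1..n} - {j}) - (A - {j}) = {1..n} - A - {j}" by auto
  ultimately have "(\<lambda>B. close_gap j ` (B - {j})) ` {A, {1..n} - A} =
      {close_gap j ` (A - {j}), {1..n - 1} - close_gap j ` (A - {j})}"
    by (simp only: image_insert image_empty)
  \<comment> \<open>An empty block stays empty under deletion, so discarding it beforehand changes
    nothing.\<close>
  moreover have "(\<lambda>B. close_gap j ` (B - {j})) ` (S - {{}}) - {{}} =
      (\<lambda>B. close_gap j ` (B - {j})) ` S - {{}}" for S by auto
  ultimately show ?thesis
    unfolding delete_elem_def bipartition_def by simp
qed

text \<open>Deletion only forgets on which side \<open>j\<close> was. Taking both partitions to be
  bipartitions excludes the preimage in which \<open>j\<close> forms a third block of its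
  own.\<close>

lemma delete_elem_bipartition_eq_iff:
  assumes j: "j \<in> {1..n}" and B: "B \<subseteq> {1..n}" and C: "C \<subseteq> {1..n}"
  shows "delete_elem j (bipartition n B) = delete_elem j (bipartition n C) \<longleftrightarrow>
         bipartition n B \<in> {bipartition n (C - {j}), bipartition n (insert j C)}"
proof -
  let ?N = "{1..n} - {j}"
  have inj: "inj_on (close_gap j) ?N" and img: "close_gap j ` ?N = {1..n - 1}"
    using bij_betw_close_gap[OF j] by (auto simp: bij_betw_def)
  have sub: "close_gap j ` (E - {j}) \<subseteq> {1..n - 1}" if "E \<subseteq> {1..n}" for E
    using that img by blast
  have diff: "{1..n - 1} - close_gap j ` (C - {j}) = close_gap j ` (?N - (C - {j}))"
    unfolding img[symmetric]
    by (rule inj_on_image_set_diff[OF inj, symmetric]) (use C in auto)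
  have "delete_elem j (bipartition n B) = delete_elem j (bipartition n C) \<longleftrightarrow>
      close_gap j ` (B - {j}) = close_gap j ` (C - {j}) \<or>
      close_gap j ` (B - {j}) = close_gap j ` (?N - (C - {j}))"
    unfolding delete_elem_bipartition[OF j B] delete_elem_bipartition[OF j C]
      bipartition_eq_iff[OF sub[OF B] sub[OF C]] diff ..
  also have "\<dots> \<longleftrightarrow> B - {j} = C - {j} \<or> B - {j} = ?N - (C - {j})"
  proof -
    have "B - {j} \<subseteq> ?N" "C - {j} \<subseteq> ?N" "?N - (C - {j}) \<subseteq> ?N" using B C by auto
    then show ?thesis by (simp only: inj_on_image_eq_iff[OF inj])
  qed
  \<comment> \<open>Each equation away from \<open>j\<close> splits according to whether
    \<open>j\<close> lies in \<open>B\<close>; the four cases regroup into two pairs of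
    complementary sets.\<close>
  also have "\<dots> \<longleftrightarrow> (B = C - {j} \<or> B = {1..n} - (C - {j})) \<or>
      (B = insert j C \<or> B = {1..n} - insert j C)"
    using j B C by blast
  also have "\<dots> \<longleftrightarrow> bipartition n B \<in> {bipartition n (C - {j}), bipartition n (insert j C)}"
  proof -
    have "C - {j} \<subseteq> {1..n}" "insert j C \<subseteq> {1..n}" using j C by auto
    then show ?thesis using B by (simp add: bipartition_eq_iff)
  qed
  finally show ?thesis .
qed

text \<open>The two sets differ at \<open>j\<close>, and they are not complementary because they
  agree at any other element \<open>k\<close>, which exists as \<open>n \<ge> 2\<close>. For
  \<open>n = 1\<close> both sides would be \<open>{{1}}\<close>.\<close>

lemma bipartition_Diff_neq_insert:
  assumes n: "n \<ge> 2" and j: "j \<in> {1..n}" and C: "C \<subseteq> {1..n}"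
  shows "bipartition n (C - {j}) \<noteq> bipartition n (insert j C)"
proof
  assume "bipartition n (C - {j}) = bipartition n (insert j C)"
  moreover have "C - {j} \<subseteq> {1..n}" "insert j C \<subseteq> {1..n}" using j C by auto
  ultimately have eq: "C - {j} = {1..n} - insert j C"
    by (auto simp: bipartition_eq_iff)
  define k where "k = (if j = 1 then 2 else 1 :: nat)"
  have "k \<in> {1..n}" "k \<noteq> j" using n by (auto simp: k_def)
  then show False using eq by blast
qed

text \<open>The two relabellings agree on \<open>C\<close>, which avoids \<open>i\<close> and
  \<open>i + 1\<close>, and each sends the one of these two elements that is kept to
  \<open>i\<close>.\<close>

lemma delete_elem_bipartition_shift:
  assumes "i \<ge> 1" "i + 1 \<le> n" "C \<subseteq> {1..n}" "i \<notin> C" "i + 1 \<notin> C"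
  shows "delete_elem (i + 1) (bipartition n (insert i C)) =
         delete_elem i (bipartition n (insert (i + 1) C))"
proof -
  have "close_gap (i + 1) ` C = close_gap i ` C"
    using assms by (intro image_cong) (auto simp: close_gap_def, metis Suc_lessI)
  then have "close_gap (i + 1) ` (insert i C - {i + 1}) =
      close_gap i ` (insert (i + 1) C - {i})"
    using assms by (simp add: close_gap_def insert_Diff_if)
  then show ?thesis
    using assms by (subst (1 2) delete_elem_bipartition) auto
qed

section \<open>Shifting a set down to an initial segment\<close>

text \<open>Moving an element one place down decreases the sum of the set, so the process ends, and it
  can only end at an initial segment.\<close>
lemma shift_invariant_eq_segment:
  fixes f :: "nat set \<Rightarrow> 'a"
  assumes shift: "\<And>i C. \<lbrakk>i \<ge> 1; i + 1 \<le> n; C \<subseteq> {1..n}; i \<notin> C; i + 1 \<notin> C\<rbrakk>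
      \<Longrightarrow> f (insert i C) = f (insert (i + 1) C)"
    and A: "A \<subseteq> {1..n}"
  shows "f A = f {1..card A}"
  using A
proof (induction "\<Sum>A" arbitrary: A rule: less_induct)
  case less
  have fin: "finite A" using less.prems finite_subset by blast
  show ?case
  proof (cases "\<exists>i\<ge>1. i \<notin> A \<and> i + 1 \<in> A")
    case True
    then obtain i where i: "i \<ge> 1" "i \<notin> A" "i + 1 \<in> A" by blast
    define C where "C = A - {i + 1}"
    have A_eq: "A = insert (i + 1) C" using i by (auto simp: C_def)
    have C: "finite C" "C \<subseteq> {1..n}" "i \<notin> C" "i + 1 \<notin> C"
      using fin less.prems i by (auto simp: C_def)
    have i': "i + 1 \<le> n" using i less.prems by auto
    have "f A = f (insert i C)" using shift[OF i(1) i' C(2-4)] A_eq by simp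
    also have "\<dots> = f {1..card (insert i C)}"
      by (rule less.hyps) (use A_eq C i i' in auto)
    also have "card (insert i C) = card A" using A_eq C by simp
    finally show ?thesis .
  next
    case False
    \<comment> \<open>With no positive gap just below an element, \<open>A\<close> is downward
      closed among the positive integers.\<close>
    have down: "m \<in> A \<Longrightarrow> 1 \<le> k \<Longrightarrow> k \<le> m \<Longrightarrow> k \<in> A" for k m
    proof (induction m)
      case (Suc m)
      show ?case
      proof (cases "k = Suc m")
        case True
        then show ?thesis using Suc.prems by simp
      next
        case k: False
        then have "m \<ge> 1" using Suc.prems by linarith
        then have "m \<in> A" using False Suc.prems(1) by auto
        then show ?thesis using Suc k by simp
      qed
    qed simp
    have "\<exists>m. A = {1..m}"
    proof (cases "A = {}")
      case True
      then show ?thesis by (intro exI[of _ 0]) simp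
    next
      case ne: False
      have "A = {1..Max A}"
        using down[OF Max_in[OF fin ne]] less.prems Max_ge[OF fin] by fastforce
      then show ?thesis by blast
    qed
    then show ?thesis by auto
  qed
qed

section \<open>Block sizes of bipartitions\<close>

text \<open>The truncated multiset difference discards the sizes of empty sides. Two zeros are
  subtracted because both sides are empty when \<open>n = 0\<close>.\<close>

lemma block_sizes_bipartition:
  assumes A: "A \<subseteq> {1..n}"
  shows "block_sizes (bipartition n A) = {#card A, n - card A#} - {#0, 0#}"
proof -
  have fin: "finite A" using A finite_subset by blast
  have c: "card ({1..n} - A) = n - card A" using A fin by (simp add: card_Diff_subset)
  consider "A = {}" | "A = {1..n}" "n \<ge> 1" | "A \<noteq> {}" "A \<noteq> {1..n}" by fastforce
  then show ?thesis
  proof cases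
    case 1
    then have "bipartition n A = (if n = 0 then {} else {{1..n}})"
      by (auto simp: bipartition_def)
    then show ?thesis using 1 by (auto simp: block_sizes_def)
  next
    case 2
    then have "bipartition n A = {{1..n}}" by (auto simp: bipartition_def)
    then show ?thesis using 2 by (auto simp: block_sizes_def)
  next
    case 3
    then have ne: "{1..n} - A \<noteq> {}" using A by blast
    then have "card ({1..n} - A) > 0" by (simp add: card_gt_0_iff del: card_Diff_subset)
    then have pos: "card A \<noteq> 0" "n - card A \<noteq> 0" using c 3 fin by auto
    have "bipartition n A = {A, {1..n} - A}" using 3 ne by (auto simp: bipartition_def)
    moreover have "A \<noteq> {1..n} - A" using 3 by blast
    ultimately show ?thesis using pos c by (auto simp: block_sizes_def)
  qed
qed

lemma block_sizes_bipartition_eqD: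
  assumes A: "A \<subseteq> {1..n}" and B: "B \<subseteq> {1..n}"
    and eq: "block_sizes (bipartition n A) = block_sizes (bipartition n B)"
  shows "card A = card B \<or> card A = n - card B"
proof -
  have le: "card A \<le> n" "card B \<le> n" using card_mono[OF _ A] card_mono[OF _ B] by auto
  have "{#card A, n - card A#} - {#0, 0#} = {#card B, n - card B#} - {#0, 0#}"
    using eq unfolding block_sizes_bipartition[OF A] block_sizes_bipartition[OF B] .
  \<comment> \<open>The case split settles which of the sizes are zero and hence disappear in the
    difference.\<close>
  then show ?thesis
    using le by (cases "card A = 0"; cases "card A = n"; cases "card B = 0"; cases "card B = n")
      (auto simp: add_eq_conv_ex)
qed

lemma card_eq_of_block_sizes_eq:
  assumes "block_sizes P = block_sizes Q"
  shows "card P = card Q"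
  using arg_cong[OF assms, of size] by (simp add: block_sizes_def)

section \<open>Probabilities of partitions under spreadability\<close>

text \<open>Singletons are measurable in the counting space, and a \<open>P\<close> outside
  \<open>set_partitions n\<close> gives the empty event.\<close>

lemma random_partition_sets:
  assumes "random_partition M n X"
  shows "{\<omega> \<in> space M. X \<omega> = P} \<in> sets M"
proof (cases "P \<in> set_partitions n")
  case True
  then have "X -` {P} \<inter> space M \<in> sets M"
    using assms unfolding random_partition_def by (intro measurable_sets) auto
  then show ?thesis by (simp add: vimage_def Int_def conj_commute)
next
  case False
  have "X \<omega> \<in> set_partitions n" if "\<omega> \<in> space M" for \<omega>
    using measurable_space[OF assms[unfolded random_partition_def] that] by simp
  then have "{\<omega> \<in> space M. X \<omega> = P} = {}" using False by blast
  then show ?thesis by (simp only: sets.empty_sets)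
qed

text \<open>The equal distributions are evaluated at the singleton \<open>{R}\<close>.\<close>

lemma spreadable_prob_delete_elem_eq:
  assumes X: "random_partition M n X" and S: "spreadable M n X"
    and i: "i \<in> {1..n}" and j: "j \<in> {1..n}" and R: "R \<in> set_partitions (n - 1)"
  shows "\<P>(\<omega> in M. delete_elem i (X \<omega>) = R) = \<P>(\<omega> in M. delete_elem j (X \<omega>) = R)"
proof -
  let ?N = "count_space (set_partitions (n - 1))"
  have m: "measure (distr M ?N (\<lambda>\<omega>. delete_elem k (X \<omega>))) {R} =
      \<P>(\<omega> in M. delete_elem k (X \<omega>) = R)" if "k \<in> {1..n}" for k
  proof -
    have "(\<lambda>\<omega>. delete_elem k (X \<omega>)) \<in> measurable M ?N"
      using random_partition_delete_elem[OF X that] by (simp add: random_partition_def)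
    then show ?thesis
      using R by (simp add: measure_distr vimage_def Int_def conj_commute)
  qed
  show ?thesis
    using S i j unfolding m[OF i, symmetric] m[OF j, symmetric] spreadable_def by metis
qed

context prob_space
begin

lemma prob_delete_elem_bipartition:
  assumes X: "random_partition M n X" and two: "AE \<omega> in M. card (X \<omega>) \<le> 2"
    and n: "n \<ge> 2" and j: "j \<in> {1..n}" and C: "C \<subseteq> {1..n}"
  shows "\<P>(\<omega> in M. delete_elem j (X \<omega>) = delete_elem j (bipartition n C)) =
         \<P>(\<omega> in M. X \<omega> = bipartition n (C - {j})) + \<P>(\<omega> in M. X \<omega> = bipartition n (insert j C))"
proof -
  let ?P = "bipartition n (C - {j})" and ?Q = "bipartition n (insert j C)"
  let ?R = "delete_elem j (bipartition n C)"
  have ne: "?P \<noteq> ?Q" by (rule bipartition_Diff_neq_insert[OF n j C])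
  have meas: "{\<omega> \<in> space M. delete_elem j (X \<omega>) = ?R} \<in> sets M"
    by (rule random_partition_sets[OF random_partition_delete_elem[OF X j]])
  \<comment> \<open>The two events agree only almost surely: \<open>?R\<close> may also arise from a
    partition with three blocks, which has probability zero.\<close>
  have "\<P>(\<omega> in M. delete_elem j (X \<omega>) = ?R) = \<P>(\<omega> in M. X \<omega> = ?P \<or> X \<omega> = ?Q)"
  proof (rule finite_measure_eq_AE)
    show "AE \<omega> in M. \<omega> \<in> {\<omega> \<in> space M. delete_elem j (X \<omega>) = ?R} \<longleftrightarrow>
        \<omega> \<in> {\<omega> \<in> space M. X \<omega> = ?P \<or> X \<omega> = ?Q}"
      using two AE_space
    proof eventually_elim
      case (elim \<omega>)
      have "X \<omega> \<in> set_partitions n"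
        using X elim(2) by (auto simp: random_partition_def dest: measurable_space)
      then obtain B where B: "B \<subseteq> {1..n}" "X \<omega> = bipartition n B"
        using elim(1) by (rule set_partitions_card_le_2E)
      then show ?case
        using delete_elem_bipartition_eq_iff[OF j B(1) C] elim(2) by simp
    qed
    show "{\<omega> \<in> space M. X \<omega> = ?P \<or> X \<omega> = ?Q} \<in> sets M"
      by (rule sets.sets_Collect_disj) (rule random_partition_sets[OF X])+
  qed (rule meas)
  also have "{\<omega> \<in> space M. X \<omega> = ?P \<or> X \<omega> = ?Q} =
      {\<omega> \<in> space M. X \<omega> = ?P} \<union> {\<omega> \<in> space M. X \<omega> = ?Q}" by auto
  also have "prob \<dots> = \<P>(\<omega> in M. X \<omega> = ?P) + \<P>(\<omega> in M. X \<omega> = ?Q)"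
    by (rule finite_measure_Union) (use ne random_partition_sets[OF X] in auto)
  finally show ?thesis .
qed

lemma prob_bipartition_shift:
  assumes X: "random_partition M n X" and S: "spreadable M n X"
    and two: "AE \<omega> in M. card (X \<omega>) \<le> 2"
    and i: "i \<ge> 1" "i + 1 \<le> n" and C: "C \<subseteq> {1..n}" "i \<notin> C" "i + 1 \<notin> C"
  shows "\<P>(\<omega> in M. X \<omega> = bipartition n (insert i C)) =
         \<P>(\<omega> in M. X \<omega> = bipartition n (insert (i + 1) C))"
proof -
  have n: "n \<ge> 2" and mem: "i \<in> {1..n}" "i + 1 \<in> {1..n}" using i by auto
  have sub: "insert i C \<subseteq> {1..n}" "insert (i + 1) C \<subseteq> {1..n}" using mem C by auto
  let ?R = "delete_elem i (bipartition n (insert (i + 1) C))"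
  have R: "?R = delete_elem (i + 1) (bipartition n (insert i C))"
    using delete_elem_bipartition_shift[OF i C] by simp
  have R_in: "?R \<in> set_partitions (n - 1)"
    using mem(1) bipartition_in_set_partitions[OF sub(2)] by (rule delete_elem_in_set_partitions)
  \<comment> \<open>The first term is the probability for \<open>insert i C\<close>, as
    \<open>i + 1\<close> is not in that set. The second, for \<open>C\<close> with both elements
    added, recurs after deleting \<open>i\<close> and cancels.\<close>
  have "\<P>(\<omega> in M. X \<omega> = bipartition n (insert i C - {i + 1})) +
        \<P>(\<omega> in M. X \<omega> = bipartition n (insert (i + 1) (insert i C))) =
        \<P>(\<omega> in M. delete_elem (i + 1) (X \<omega>) = ?R)"
    unfolding R by (rule prob_delete_elem_bipartition[OF X two n mem(2) sub(1), symmetric])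
  also have "\<dots> = \<P>(\<omega> in M. delete_elem i (X \<omega>) = ?R)"
    by (rule spreadable_prob_delete_elem_eq[OF X S mem(2,1) R_in])
  also have "\<dots> = \<P>(\<omega> in M. X \<omega> = bipartition n (insert (i + 1) C - {i})) +
        \<P>(\<omega> in M. X \<omega> = bipartition n (insert i (insert (i + 1) C)))"
    by (rule prob_delete_elem_bipartition[OF X two n mem(1) sub(2)])
  finally show ?thesis
    using C by (simp add: insert_Diff_if insert_commute[of i])
qed

lemma exchangeable_if_spreadable_card_le_2:
  assumes X: "random_partition M n X" and S: "spreadable M n X"
    and two: "AE \<omega> in M. card (X \<omega>) \<le> 2"
  shows "exchangeable M n X"
  unfolding exchangeable_def
proof (intro ballI impI)
  fix P Q assume P: "P \<in> set_partitions n" and Q: "Q \<in> set_partitions n"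
    and eq: "block_sizes P = block_sizes Q"
  define f where "f A = \<P>(\<omega> in M. X \<omega> = bipartition n A)" for A
  have f_segment: "f A = f {1..card A}" if "A \<subseteq> {1..n}" for A
    by (rule shift_invariant_eq_segment[OF _ that])
      (unfold f_def, rule prob_bipartition_shift[OF X S two])
  have card_eq: "card P = card Q" using eq by (rule card_eq_of_block_sizes_eq)
  show "\<P>(\<omega> in M. X \<omega> = P) = \<P>(\<omega> in M. X \<omega> = Q)"
  proof (cases "card P \<le> 2")
    case True
    obtain A where A: "A \<subseteq> {1..n}" "P = bipartition n A"
      using P True by (rule set_partitions_card_le_2E)
    obtain B where B: "B \<subseteq> {1..n}" "Q = bipartition n B"
      using Q True[unfolded card_eq] by (rule set_partitions_card_le_2E)
    \<comment> \<open>Block sizes fix the cardinality only up to swapping the two sides, so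
      \<open>B\<close> may have to be replaced by its complement, which encodes the same
      partition.\<close>
    have "card A = card B \<or> card A = card ({1..n} - B)"
      using block_sizes_bipartition_eqD[OF A(1) B(1)] eq A(2) B
      by (simp add: card_Diff_subset finite_subset[OF B(1)])
    moreover have "f ({1..n} - B) = f B" by (simp only: f_def bipartition_Diff[OF B(1)])
    ultimately have "f A = f B"
      using f_segment[OF A(1)] f_segment[OF B(1)] f_segment[of "{1..n} - B"] by auto
    then show ?thesis by (simp add: f_def A(2) B(2))
  next
    case False
    \<comment> \<open>Since \<open>P\<close> and \<open>Q\<close> have equally many blocks, both
      have more than two here, and both probabilities vanish.\<close>
    have "\<P>(\<omega> in M. X \<omega> = R) = 0" if "\<not> card R \<le> 2" for R
    proof -
      have "AE \<omega> in M. X \<omega> \<noteq> R" using two by eventually_elim (use that in auto)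
      then have "\<P>(\<omega> in M. X \<omega> = R) = \<P>(\<omega> in M. False)"
        by (intro finite_measure_eq_AE random_partition_sets[OF X]) auto
      then show ?thesis by simp
    qed
    then show ?thesis using False card_eq by simp
  qed
qed

end

theorem proposition2:
  fixes M :: "'w measure" and n :: nat and X :: "'w \<Rightarrow> nat set set"
  assumes "prob_space M"
    and "n \<ge> 1"
    and "random_partition M n X"
    and "spreadable M n X"
    and "AE \<omega> in M. card (X \<omega>) \<le> 2"
  shows "exchangeable M n X"
  using assms(1,3-5) by (rule prob_space.exchangeable_if_spreadable_card_le_2)

end
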